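(* For any integers $2<k<n$, the lattice of flats of the uniform matroid $U(k,n)$ is not isomorphic to the core of any upho lattice.
   Context: For $2\le k\le n$, the lattice of flats of the uniform matroid $U(k,n)$ is the poset obtained from the Boolean lattice $B_n$ (subsets of $\{1,\ldots,n\}$ ordered by inclusion) by removing all subsets of size $\ge k$ and then adjoining a new maximum element $\hat1$. A poset $\mathcal{P}$ is finite type $\mathbb{N}$-graded if it has a minimum $\hat0$, a rank function $\rho$ with $\rho(\hat0)=0$ such that every maximal chain has the form $\hat0=x_0\lessdot x_1\lessdot\cdots$ with $\rho(x_i)=i$, and finitely many elements of each rank. An upho lattice is a finite type $\mathbb{N}$-graded lattice $\mathcal{L}$ with at least two elements such that for every $p\in\mathcal{L}$ the principal filter $\{q\ge p\}$ is isomorphic to $\mathcal{L}$. Its core is the interval $[\hat0,s_1\vee\cdots\vee s_r]$ with $s_1,\ldots,s_r$ the atoms of $\mathcal{L}$. *)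

theory Defs
  imports "HOL-Algebra.Lattice"
begin

definition order_isomorphic :: "('a, 'c) gorder_scheme \<Rightarrow> ('b, 'd) gorder_scheme \<Rightarrow> bool" where
  "order_isomorphic A B \<longleftrightarrow> (\<exists>f. order_emb A B f \<and> bij_betw f (carrier A) (carrier B))"

definition covered_by :: "('a, 'c) gorder_scheme \<Rightarrow> 'a \<Rightarrow> 'a \<Rightarrow> bool" where
  "covered_by L x y \<longleftrightarrow>
     x \<in> carrier L \<and> y \<in> carrier L \<and> x \<sqsubset>\<^bsub>L\<^esub> y \<and>
     \<not> (\<exists>z\<in>carrier L. x \<sqsubset>\<^bsub>L\<^esub> z \<and> z \<sqsubset>\<^bsub>L\<^esub> y)"

definition atoms :: "('a, 'c) gorder_scheme \<Rightarrow> 'a set" where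
  "atoms L = {s. covered_by L \<bottom>\<^bsub>L\<^esub> s}"

text \<open>The chain \<open>x 0 \<lessdot> x 1 \<lessdot> \<dots>\<close> is indexed by \<open>I\<close>, all of \<open>\<nat>\<close> or an initial segment of it, so that
  a poset with a finite maximal chain (such as the one-element poset) is not excluded here.
  In an upho lattice every maximal chain is infinite, since no element is maximal.\<close>

definition finite_type_nat_graded :: "('a, 'c) gorder_scheme \<Rightarrow> bool" where
  "finite_type_nat_graded L \<longleftrightarrow>
     partial_order L \<and>
     (\<exists>z. least L z (carrier L)) \<and>
     (\<exists>\<rho> :: 'a \<Rightarrow> nat.
        \<rho> \<bottom>\<^bsub>L\<^esub> = 0 \<and>
        (\<forall>C. pred_on.maxchain (carrier L) (le L) C \<longrightarrow>
           (\<exists>x I. (I = UNIV \<or> (\<exists>m. I = {..m})) \<and> C = x ` I \<and> x 0 = \<bottom>\<^bsub>L\<^esub> \<and>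
              (\<forall>i. Suc i \<in> I \<longrightarrow> covered_by L (x i) (x (Suc i))) \<and>
              (\<forall>i\<in>I. \<rho> (x i) = i))) \<and>
        (\<forall>i. finite {p \<in> carrier L. \<rho> p = i}))"

definition upho_lattice :: "('a, 'c) gorder_scheme \<Rightarrow> bool" where
  "upho_lattice L \<longleftrightarrow>
     lattice L \<and> finite_type_nat_graded L \<and>
     (\<exists>x\<in>carrier L. \<exists>y\<in>carrier L. x \<noteq> y) \<and>
     (\<forall>p\<in>carrier L.
        order_isomorphic (L\<lparr>carrier := {q \<in> carrier L. p \<sqsubseteq>\<^bsub>L\<^esub> q}\<rparr>) L)"

definition core :: "('a, 'c) gorder_scheme \<Rightarrow> ('a, 'c) gorder_scheme" where
  "core L = L\<lparr>carrier := \<lbrace>\<bottom>\<^bsub>L\<^esub>..\<Squnion>\<^bsub>L\<^esub>(atoms L)\<rbrace>\<^bsub>L\<^esub>\<rparr>"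

text \<open>For \<open>k \<le> n\<close> the ground set \<open>{1..n}\<close> has at least \<open>k\<close> elements, so it is not among the
  subsets that are kept; it serves as the adjoined maximum (and is the flat of rank \<open>k\<close>).\<close>

definition uniform_flats :: "nat \<Rightarrow> nat \<Rightarrow> nat set gorder" where
  "uniform_flats k n =
     \<lparr>carrier = insert {1..n} {A. A \<subseteq> {1..n} \<and> card A < k}, eq = (=), le = (\<subseteq>)\<rparr>"

end

theory Submission
  imports Defs
begin

text \<open>In the flats of \<open>U(k,n)\<close> with \<open>k > 2\<close>, the join of two atoms lies above no third atom.
  An upho lattice \<open>L\<close> with this core inherits the property at the covers of each of its
  elements. Yet a flat of cardinality \<open>k - 2\<close> has \<open>n - k + 2 \<ge> 3\<close> covers of the form
  \<open>{1..k-2} \<union> {j}\<close>, any two of which join to the top of the core.\<close>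

section \<open>Covers, maximal chains and the join of the atoms\<close>

lemma order_emb_le_iff:
  assumes "order_emb A B f" "x \<in> carrier A" "y \<in> carrier A"
  shows "f x \<sqsubseteq>\<^bsub>B\<^esub> f y \<longleftrightarrow> x \<sqsubseteq>\<^bsub>A\<^esub> y"
  using assms by (simp add: order_emb_def)

lemma (in partial_order) covered_by_iff:
  "covered_by L x y \<longleftrightarrow> x \<in> carrier L \<and> y \<in> carrier L \<and> x \<sqsubseteq> y \<and> x \<noteq> y \<and>
     (\<forall>z\<in>carrier L. x \<sqsubseteq> z \<longrightarrow> z \<sqsubseteq> y \<longrightarrow> z = x \<or> z = y)"
  by (auto simp: covered_by_def lless_eq)

text \<open>Gradedness speaks only of maximal chains, so the rank of \<open>s\<close> is accessible
  only through one that contains \<open>s\<close>. Take a maximal chain among the elements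
  comparable to \<open>s\<close>: maximality forces \<open>s\<close> into it, and every larger chain
  of \<open>L\<close> then contains \<open>s\<close> and so still consists of elements comparable to
  \<open>s\<close>.\<close>

lemma (in partial_order) ex_maxchain_through:
  assumes s: "s \<in> carrier L"
  shows "\<exists>C. pred_on.maxchain (carrier L) (le L) C \<and> s \<in> C"
proof -
  define A where "A = {x \<in> carrier L. x \<sqsubseteq> s \<or> s \<sqsubseteq> x}"
  obtain C where C: "pred_on.maxchain A (le L) C"
    using pred_on.Hausdorff by blast
  have chC: "pred_on.chain A (le L) C"
    using C by (simp add: pred_on.maxchain_def)
  have ins: "pred_on.chain A (le L) (insert s C)"
    using chC s by (auto simp: pred_on.chain_def A_def)
  have sC: "s \<in> C"
    using C ins by (auto simp: pred_on.maxchain_def)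
  have "pred_on.chain (carrier L) (le L) C"
    using chC by (auto simp: pred_on.chain_def A_def)
  moreover have "\<not> C \<subset> S" if "pred_on.chain (carrier L) (le L) S" for S
  proof
    assume sub: "C \<subset> S"
    then have "pred_on.chain A (le L) S"
      using that sC unfolding pred_on.chain_def A_def by blast
    then show False using C sub that by (auto simp: pred_on.maxchain_def)
  qed
  ultimately show ?thesis using sC by (auto simp: pred_on.maxchain_def)
qed

text \<open>Every atom has rank 1: on a maximal chain through it, the element after the minimum is
  comparable to the atom, and two comparable covers of the minimum coincide.\<close>

lemma finite_atoms:
  assumes "finite_type_nat_graded L"
  shows "finite (atoms L)"
proof -
  from assms obtain \<rho> :: "'a \<Rightarrow> nat" where po: "partial_order L"
    and ex: "\<exists>z. least L z (carrier L)" and r0: "\<rho> \<bottom>\<^bsub>L\<^esub> = 0"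
    and chains: "\<And>C. pred_on.maxchain (carrier L) (le L) C \<Longrightarrow>
           (\<exists>x I. (I = UNIV \<or> (\<exists>m. I = {..m})) \<and> C = x ` I \<and> x 0 = \<bottom>\<^bsub>L\<^esub> \<and>
              (\<forall>i. Suc i \<in> I \<longrightarrow> covered_by L (x i) (x (Suc i))) \<and>
              (\<forall>i\<in>I. \<rho> (x i) = i))"
    and fin: "\<And>i. finite {p \<in> carrier L. \<rho> p = i}"
    unfolding finite_type_nat_graded_def by blast
  interpret partial_order L by (fact po)
  have "\<rho> s = 1 \<and> s \<in> carrier L" if "s \<in> atoms L" for s
  proof -
    have cov: "covered_by L \<bottom>\<^bsub>L\<^esub> s" using that by (simp add: atoms_def)
    then have sc: "s \<in> carrier L" and ne: "s \<noteq> \<bottom>\<^bsub>L\<^esub>" by (auto simp: covered_by_iff)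
    obtain C where C: "pred_on.maxchain (carrier L) (le L) C" "s \<in> C"
      using ex_maxchain_through[OF sc] by blast
    obtain x I where I: "I = UNIV \<or> (\<exists>m. I = {..m})" "C = x ` I" "x 0 = \<bottom>\<^bsub>L\<^esub>"
      "\<And>i. Suc i \<in> I \<Longrightarrow> covered_by L (x i) (x (Suc i))" "\<And>i. i \<in> I \<Longrightarrow> \<rho> (x i) = i"
      using chains[OF C(1)] by blast
    obtain i where i: "i \<in> I" "s = x i" using C(2) I(2) by blast
    have "i \<noteq> 0" using ne i I(3) by (auto intro: gr0I)
    \<comment> \<open>\<open>I\<close> is an initial segment or everything, so a nonzero index in it
      forces 1 into it.\<close>
    then have 1: "Suc 0 \<in> I" using I(1) i(1) by auto
    have cov1: "covered_by L \<bottom>\<^bsub>L\<^esub> (x (Suc 0))" using I(4)[OF 1] I(3) by simp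
    have "x (Suc 0) \<in> C" using 1 I(2) by blast
    then have "x (Suc 0) \<sqsubseteq>\<^bsub>L\<^esub> s \<or> s \<sqsubseteq>\<^bsub>L\<^esub> x (Suc 0)"
      using pred_on.maxchain_imp_chain[OF C(1)] C(2) sc
      unfolding pred_on.chain_def by (metis le_refl sup2E)
    then have "s = x (Suc 0)" using cov cov1 unfolding covered_by_iff by metis
    then show ?thesis using I(5)[OF 1] sc by simp
  qed
  then have "atoms L \<subseteq> {p \<in> carrier L. \<rho> p = 1}" by blast
  then show ?thesis using fin finite_subset by blast
qed

text \<open>The join of a set is a choice term, meaningful only once some least upper bound exists.
  A lattice provides one for finite nonempty sets; for the empty set it is the minimum.\<close>

lemma sup_atoms_is_lub:
  assumes "lattice L" "finite_type_nat_graded L"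
  shows "is_lub L (\<Squnion>\<^bsub>L\<^esub>(atoms L)) (atoms L)"
proof -
  interpret lattice L by fact
  have sub: "atoms L \<subseteq> carrier L" by (auto simp: atoms_def covered_by_def)
  show ?thesis
  proof (cases "atoms L = {}")
    case True
    obtain z where "least L z (carrier L)"
      using assms(2) by (auto simp: finite_type_nat_graded_def)
    then have "is_lub L z (atoms L)" using True by simp
    then show ?thesis unfolding sup_def by (rule someI)
  next
    case False
    then show ?thesis using finite_sup_least[OF finite_atoms[OF assms(2)] sub] by simp
  qed
qed

section \<open>Upho lattices whose core consists of uniform flats\<close>

lemma uniform_flats_simps [simp]:
  "A \<in> carrier (uniform_flats k n) \<longleftrightarrow> A = {1..n} \<or> A \<subseteq> {1..n} \<and> card A < k"
  "le (uniform_flats k n) = (\<subseteq>)"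
  by (auto simp: uniform_flats_def)

text \<open>A hypothetical counterexample to the theorem, together with its isomorphism
  \<open>f\<close> onto the core; the context ends in \<open>False\<close>.\<close>

locale upho_uniform_core = lattice L for L :: "('a, 'c) gorder_scheme" (structure) +
  fixes k n :: nat and f :: "nat set \<Rightarrow> 'a"
  assumes upho: "upho_lattice L"
    and emb: "order_emb (uniform_flats k n) (core L) f"
    and bij: "bij_betw f (carrier (uniform_flats k n)) (carrier (core L))"
    and k: "2 < k" and kn: "k < n"
begin

abbreviation T where "T \<equiv> \<Squnion>(atoms L)"

sublocale weak_partial_order_bottom L
  using upho by unfold_locales (auto simp: upho_lattice_def finite_type_nat_graded_def)

lemma T_lub: "is_lub L T (atoms L)"
  using upho sup_atoms_is_lub unfolding upho_lattice_def by blast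

lemma T_closed [simp]: "T \<in> carrier L"
  using T_lub by simp

lemma core_carrier: "x \<in> carrier (core L) \<longleftrightarrow> x \<in> carrier L \<and> x \<sqsubseteq> T"
  by (auto simp: core_def at_least_at_most_def)

lemma f_core: "A \<in> carrier (uniform_flats k n) \<Longrightarrow> f A \<in> carrier L \<and> f A \<sqsubseteq> T"
  using bij_betw_apply[OF bij] core_carrier by blast

lemma f_le_iff:
  "A \<in> carrier (uniform_flats k n) \<Longrightarrow> B \<in> carrier (uniform_flats k n) \<Longrightarrow> f A \<sqsubseteq> f B \<longleftrightarrow> A \<subseteq> B"
  using order_emb_le_iff[OF emb] by (simp add: core_def)

lemma f_surj:
  assumes "x \<in> carrier L" "x \<sqsubseteq> T"
  obtains A where "A \<in> carrier (uniform_flats k n)" "x = f A"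
  using assms bij core_carrier unfolding bij_betw_def by (metis imageE)

text \<open>An atom lies below \<open>T\<close>, so it is \<open>f A\<close> for some flat
  \<open>A\<close>, nonempty because the minimum is \<open>f {}\<close>. For \<open>i\<close> in
  \<open>A\<close>, the element \<open>f {i}\<close> lies above the minimum and below the atom,
  hence equals it.\<close>

lemma atom_singleton:
  assumes "a \<in> atoms L"
  obtains i where "i \<in> {1..n}" "a = f {i}"
proof -
  have cov: "covered_by L \<bottom> a" using assms by (simp add: atoms_def)
  then have a: "a \<in> carrier L" "a \<noteq> \<bottom>" by (auto simp: covered_by_iff)
  have "a \<sqsubseteq> T" by (rule least_Upper_above[OF T_lub assms]) (auto simp: atoms_def covered_by_def)
  then obtain A where A: "A \<in> carrier (uniform_flats k n)" "a = f A"
    using f_surj a by metis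
  obtain B where B: "B \<in> carrier (uniform_flats k n)" "\<bottom> = f B"
    using f_surj by (metis T_closed bottom_closed bottom_lower)
  have flat: "{i} \<in> carrier (uniform_flats k n)" if "i \<in> {1..n}" for i
    using that k by auto
  have flat0: "{} \<in> carrier (uniform_flats k n)" using k by auto
  have "B = {}" using f_le_iff[OF B(1) flat0] B(2) f_core[OF flat0] by (metis bottom_lower subset_empty)
  then have "A \<noteq> {}" using a A B by auto
  then obtain i where i: "i \<in> A" by blast
  then have i': "i \<in> {1..n}" using A(1) by auto
  have "f {i} \<sqsubseteq> a" using f_le_iff[OF flat[OF i'] A(1)] i A(2) by simp
  moreover have "f {i} \<noteq> \<bottom>"
    using f_le_iff[OF flat[OF i'] B(1)] B(2) \<open>B = {}\<close> by (metis bottom_closed le_refl insert_not_empty subset_empty)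
  ultimately have "f {i} = a"
    using cov f_core[OF flat[OF i']] bottom_lower by (auto simp: covered_by_iff)
  then show thesis using that i' by blast
qed

text \<open>The witness is \<open>f {i, j}\<close>, and \<open>{i, j}\<close> is a flat because
  \<open>2 < k\<close>. Asking for a separating upper bound instead of naming a join lets the
  property pass through order isomorphisms directly.\<close>

lemma atoms_separated:
  assumes "a \<in> atoms L" "b \<in> atoms L" "c \<in> atoms L" "a \<noteq> c" "b \<noteq> c"
  shows "\<exists>u\<in>carrier L. a \<sqsubseteq> u \<and> b \<sqsubseteq> u \<and> \<not> c \<sqsubseteq> u"
proof -
  obtain i j l where ijl: "i \<in> {1..n}" "a = f {i}" "j \<in> {1..n}" "b = f {j}" "l \<in> {1..n}" "c = f {l}"
    using atom_singleton assms(1-3) by metis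
  have "card {i, j} < k" using k card_insert_le_m1[of 2 "{j}" i] by simp
  then have fl: "{i} \<in> carrier (uniform_flats k n)" "{j} \<in> carrier (uniform_flats k n)"
    "{l} \<in> carrier (uniform_flats k n)" "{i, j} \<in> carrier (uniform_flats k n)"
    using ijl k by auto
  have "a \<sqsubseteq> f {i, j}" "b \<sqsubseteq> f {i, j}" "\<not> c \<sqsubseteq> f {i, j}"
    using fl assms(4,5) ijl by (auto simp only: f_le_iff)
  then show ?thesis using f_core[OF fl(4)] by blast
qed

text \<open>The upho isomorphism \<open>g\<close> from the filter above \<open>p\<close> to
  \<open>L\<close> turns covers of \<open>p\<close> into atoms, so a bound separating the images
  pulls back. This bound need not lie in the core.\<close>

lemma covers_separated:
  assumes "covered_by L p a" "covered_by L p b" "covered_by L p c" "a \<noteq> c" "b \<noteq> c"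
  shows "\<exists>u\<in>carrier L. a \<sqsubseteq> u \<and> b \<sqsubseteq> u \<and> \<not> c \<sqsubseteq> u"
proof -
  define F where "F = {q \<in> carrier L. p \<sqsubseteq> q}"
  have p: "p \<in> carrier L" using assms(1) by (simp add: covered_by_def)
  then obtain g where g: "order_emb (L\<lparr>carrier := F\<rparr>) L g" "bij_betw g F (carrier L)"
    using upho by (auto simp: upho_lattice_def order_isomorphic_def F_def)
  have g_le: "g x \<sqsubseteq> g y \<longleftrightarrow> x \<sqsubseteq> y" if "x \<in> F" "y \<in> F" for x y
    using order_emb_le_iff[OF g(1)] that by simp
  have surj: "\<exists>x\<in>F. y = g x" if "y \<in> carrier L" for y
    using that g(2) by (auto simp: bij_betw_def)
  have g_in: "g x \<in> carrier L" if "x \<in> F" for x using that g(2) bij_betw_apply by metis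
  have g_inj: "g x = g y \<longleftrightarrow> x = y" if "x \<in> F" "y \<in> F" for x y
    using that g(2) by (auto simp: bij_betw_def inj_on_def)
  have pF: "p \<in> F" using p by (simp add: F_def)
  have gp: "g p = \<bottom>"
  proof -
    obtain x where x: "x \<in> F" "\<bottom> = g x" using surj bottom_closed by blast
    then have "g p \<sqsubseteq> \<bottom>" using g_le[OF pF x(1)] by (simp add: F_def)
    then show ?thesis using g_in[OF pF] by (simp add: le_antisym)
  qed
  have atom: "g x \<in> atoms L \<and> x \<in> F" if cov: "covered_by L p x" for x
  proof -
    have x: "x \<in> F" using cov by (auto simp: F_def covered_by_iff)
    have "z = \<bottom> \<or> z = g x" if z: "z \<in> carrier L" "z \<sqsubseteq> g x" for z
    proof -
      obtain y where y: "y \<in> F" "z = g y" using surj z by blast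
      then have "y = p \<or> y = x" using z g_le[OF y(1) x] cov by (auto simp: F_def covered_by_iff)
      then show ?thesis using y gp by auto
    qed
    moreover have "g x \<noteq> \<bottom>" using g_inj[OF x pF] gp cov by (auto simp: covered_by_iff)
    ultimately show ?thesis using g_in[OF x] x by (auto simp: atoms_def covered_by_iff)
  qed
  note at = atom[OF assms(1)] atom[OF assms(2)] atom[OF assms(3)]
  obtain u where u: "u \<in> carrier L" "g a \<sqsubseteq> u" "g b \<sqsubseteq> u" "\<not> g c \<sqsubseteq> u"
    using atoms_separated[of "g a" "g b" "g c"] at assms(4,5) g_inj by auto
  then obtain v where v: "v \<in> F" "u = g v" using surj by blast
  then show ?thesis using u at g_le by (auto simp: F_def)
qed

lemma inconsistent: False
proof -
  define P where "P = {1..k - 2}"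
  have cP: "card P = k - 2" "P \<subseteq> {1..n}" "finite P" using kn by (auto simp: P_def)
  have P: "P \<in> carrier (uniform_flats k n)" using cP k by simp
  have flat: "insert j P \<in> carrier (uniform_flats k n)" if "j \<in> {k - 1..n}" for j
    using that cP k by (auto simp: card_insert_if)
  \<comment> \<open>Covering must hold in all of \<open>L\<close>. The core is closed downwards, so
    any intermediate element is again the image of a flat.\<close>
  have cov: "covered_by L (f P) (f (insert j P))" if j: "j \<in> {k - 1..n}" for j
  proof -
    have jP: "j \<notin> P" using j k by (auto simp: P_def)
    have "z = f P \<or> z = f (insert j P)"
      if z: "z \<in> carrier L" "f P \<sqsubseteq> z" "z \<sqsubseteq> f (insert j P)" for z
    proof -
      have "z \<sqsubseteq> T" using z f_core[OF flat[OF j]] le_trans T_closed by blast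
      then obtain Z where Z: "Z \<in> carrier (uniform_flats k n)" "z = f Z"
        using f_surj z(1) by metis
      have "P \<subseteq> Z" "Z \<subseteq> insert j P"
        using z Z f_le_iff[OF P Z(1)] f_le_iff[OF Z(1) flat[OF j]] by auto
      then have "Z = P \<or> Z = insert j P" by blast
      then show ?thesis using Z by auto
    qed
    moreover have "f P \<sqsubseteq> f (insert j P)" "f P \<noteq> f (insert j P)"
      using f_le_iff[OF P flat[OF j]] f_le_iff[OF flat[OF j] P] jP f_core[OF P]
      by (auto simp: subset_insertI)
    ultimately show ?thesis using f_core[OF P] f_core[OF flat[OF j]]
      by (auto simp: covered_by_iff)
  qed
  \<comment> \<open>The third point \<open>k + 1\<close> exists because
    \<open>k < n\<close>.\<close>
  have mem: "k - 1 \<in> {k - 1..n}" "k \<in> {k - 1..n}" "k + 1 \<in> {k - 1..n}" using kn by auto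
  have ne: "f (insert i P) \<noteq> f (insert (k + 1) P)" if "i \<in> {k - 1..n}" "i \<noteq> k + 1" for i
  proof
    assume "f (insert i P) = f (insert (k + 1) P)"
    then have "insert (k + 1) P \<subseteq> insert i P"
      using f_le_iff[OF flat[OF mem(3)] flat[OF that(1)]] f_core[OF flat[OF mem(3)]] by simp
    then show False using that(2) by (auto simp: P_def)
  qed
  obtain u where u: "u \<in> carrier L" "f (insert (k - 1) P) \<sqsubseteq> u" "f (insert k P) \<sqsubseteq> u"
      "\<not> f (insert (k + 1) P) \<sqsubseteq> u"
    using covers_separated[OF cov[OF mem(1)] cov[OF mem(2)] cov[OF mem(3)]] ne mem by force
  \<comment> \<open>The bound \<open>u\<close> may leave the core; its meet with \<open>T\<close>
    returns to it and still lies above the first two covers.\<close>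
  have "u \<sqinter> T \<sqsubseteq> T" "u \<sqinter> T \<in> carrier L" using u by (auto simp: meet_right)
  then obtain V where V: "V \<in> carrier (uniform_flats k n)" "u \<sqinter> T = f V"
    using f_surj by metis
  have "f (insert (k - 1) P) \<sqsubseteq> f V" "f (insert k P) \<sqsubseteq> f V"
    unfolding V(2)[symmetric] using u f_core flat mem by (auto intro!: meet_le)
  then have "insert (k - 1) P \<subseteq> V" "insert k P \<subseteq> V"
    using f_le_iff[OF flat V(1)] mem by auto
  then have sub: "insert k (insert (k - 1) P) \<subseteq> V" by blast
  have "insert k (insert (k - 1) P) = {1..k}" using k by (auto simp: P_def)
  then have V1k: "{1..k} \<subseteq> V" using sub by simp
  \<comment> \<open>With at least \<open>k\<close> elements, \<open>V\<close> can only be the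
    adjoined maximum, which also contains the third cover.\<close>
  have "V = {1..n}"
  proof (rule ccontr)
    assume "V \<noteq> {1..n}"
    then have "V \<subseteq> {1..n}" "card V < k" using V(1) by auto
    then show False using card_mono[OF _ V1k] finite_subset[of V "{1..n}"] by auto
  qed
  then have "insert (k + 1) P \<subseteq> V" using kn cP by auto
  then have "f (insert (k + 1) P) \<sqsubseteq> u \<sqinter> T"
    using f_le_iff[OF flat[OF mem(3)] V(1)] V(2) by simp
  then have "f (insert (k + 1) P) \<sqsubseteq> u"
    using meet_left[OF u(1) T_closed] f_core[OF flat[OF mem(3)]] u(1) \<open>u \<sqinter> T \<in> carrier L\<close> le_trans
    by blast
  then show False using u(4) by blast
qed

end

theorem theorem5p14:
  fixes k n :: nat
  assumes "2 < k" and "k < n"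
  shows "\<not> (\<exists>L :: 'a gorder. upho_lattice L \<and> order_isomorphic (uniform_flats k n) (core L))"
proof
  assume "\<exists>L :: 'a gorder. upho_lattice L \<and> order_isomorphic (uniform_flats k n) (core L)"
  then obtain L :: "'a gorder" and f where L: "upho_lattice L"
    and f: "order_emb (uniform_flats k n) (core L) f"
      "bij_betw f (carrier (uniform_flats k n)) (carrier (core L))"
    unfolding order_isomorphic_def by blast
  interpret lattice L using L by (simp add: upho_lattice_def)
  interpret upho_uniform_core L k n f using L f assms by unfold_locales
  show False by (fact inconsistent)
qed

end
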